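(* Let $M$ be a Symmetric Perfect Matroid Design (SPMD) of rank $r$, and let $B$ be a basis of $M$. Then the number of hyperplanes $H$ of $M$ which contain no element of $B$ is precisely \[ n=\sum_{k=0}^{r-1}(-1)^k\frac{\binom{r}{k}\,\langle r \mid r-1\rangle\,\langle r-1 \mid k\rangle}{\langle r \mid k\rangle}. \]
   Context: Matroids are finite; a hyperplane is a flat of rank $\rho(E)-1$. A matroid $M$ of rank $r$ is called a Symmetric Perfect Matroid Design (SPMD) if (i) for each $j<r$, all flats of rank $j$ in $M$ are isomorphic (as matroids, under restriction), and (ii) for all $s,u$, the number of flats of rank $s$ in $M$ containing a fixed flat $M'$ of rank $u$ is a number $f(r,s,u)$ that does not depend on the choice of $M'$. For an SPMD, $\langle m \mid k\rangle$ denotes the number of flats of rank $k$ in an SPMD of rank $m$ (here: for $m=r$, the number of rank-$k$ flats of $M$; for $m=r-1$, the number of rank-$k$ flats of any hyperplane of $M$, which is well defined since all hyperplanes are isomorphic). In particular $\langle m\mid 0\rangle=1$. *)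

theory Defs
  imports Complex_Main
begin

locale matroid =
  fixes E :: "'a set" and \<I> :: "'a set set"
  assumes finite_ground: "finite E"
    and indep_subset_ground: "\<And>X. X \<in> \<I> \<Longrightarrow> X \<subseteq> E"
    and indep_empty: "{} \<in> \<I>"
    and indep_subset: "\<And>X Y. X \<in> \<I> \<Longrightarrow> Y \<subseteq> X \<Longrightarrow> Y \<in> \<I>"
    and indep_augment: "\<And>X Y. X \<in> \<I> \<Longrightarrow> Y \<in> \<I> \<Longrightarrow> card X < card Y \<Longrightarrow>
          \<exists>y \<in> Y - X. insert y X \<in> \<I>"

definition mrank :: "'a set set \<Rightarrow> 'a set \<Rightarrow> nat" where
  "mrank \<I> X = Max (card ` {Y \<in> \<I>. Y \<subseteq> X})"

definition basis :: "'a set set \<Rightarrow> 'a set \<Rightarrow> bool" where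
  "basis \<I> B \<longleftrightarrow> B \<in> \<I> \<and> (\<forall>Y \<in> \<I>. B \<subseteq> Y \<longrightarrow> Y = B)"

definition flat :: "'a set \<Rightarrow> 'a set set \<Rightarrow> 'a set \<Rightarrow> bool" where
  "flat E \<I> F \<longleftrightarrow> F \<subseteq> E \<and> (\<forall>x \<in> E - F. mrank \<I> F < mrank \<I> (insert x F))"

text \<open>Written with addition because \<open>mrank \<I> E - 1\<close> truncates: a matroid of rank 0 has no
  hyperplanes.\<close>

definition hyperplane :: "'a set \<Rightarrow> 'a set set \<Rightarrow> 'a set \<Rightarrow> bool" where
  "hyperplane E \<I> H \<longleftrightarrow> flat E \<I> H \<and> mrank \<I> H + 1 = mrank \<I> E"

text \<open>The restriction of the matroid \<open>(E, \<I>)\<close> to \<open>F \<subseteq> E\<close> is \<open>(F, restr \<I> F)\<close>.\<close>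

definition restr :: "'a set set \<Rightarrow> 'a set \<Rightarrow> 'a set set" where
  "restr \<I> F = {X \<in> \<I>. X \<subseteq> F}"

definition matroid_iso :: "'a set \<Rightarrow> 'a set set \<Rightarrow> 'b set \<Rightarrow> 'b set set \<Rightarrow> bool" where
  "matroid_iso E \<I> E' \<I>' \<longleftrightarrow>
     (\<exists>h. bij_betw h E E' \<and> (\<forall>X \<subseteq> E. X \<in> \<I> \<longleftrightarrow> h ` X \<in> \<I>'))"

definition flats_of_rank :: "'a set \<Rightarrow> 'a set set \<Rightarrow> nat \<Rightarrow> 'a set set" where
  "flats_of_rank E \<I> k = {F. flat E \<I> F \<and> mrank \<I> F = k}"

locale spmd = matroid +
  assumes flats_iso: "\<And>j F G. j < mrank \<I> E \<Longrightarrow>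
        F \<in> flats_of_rank E \<I> j \<Longrightarrow> G \<in> flats_of_rank E \<I> j \<Longrightarrow>
        matroid_iso F (restr \<I> F) G (restr \<I> G)"
    and flats_above: "\<exists>f :: nat \<Rightarrow> nat \<Rightarrow> nat. \<forall>s u. \<forall>F \<in> flats_of_rank E \<I> u.
        card {G \<in> flats_of_rank E \<I> s. F \<subseteq> G} = f s u"

text \<open>\<open>flat_number E \<I> m k\<close> is \<open>\<langle>m | k\<rangle>\<close>, the number of rank-\<open>k\<close> flats of any restriction of
  \<open>(E, \<I>)\<close> to a flat of rank \<open>m\<close>. It is specified for \<open>m \<le> mrank \<I> E\<close> in an SPMD only; see
  the lemmas \<open>flat_number_top\<close> and \<open>flat_number_hyperplane\<close>.\<close>

definition flat_number :: "'a set \<Rightarrow> 'a set set \<Rightarrow> nat \<Rightarrow> nat \<Rightarrow> nat" where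
  "flat_number E \<I> m k =
     (THE n. \<forall>F \<in> flats_of_rank E \<I> m. card (flats_of_rank F (restr \<I> F) k) = n)"

lemma (in matroid) finite_indep: "finite \<I>"
  by (rule finite_subset[of _ "Pow E"]) (use indep_subset_ground finite_ground in auto)

lemma (in matroid) mrank_mono:
  assumes "X \<subseteq> Y" shows "mrank \<I> X \<le> mrank \<I> Y"
  unfolding mrank_def
  by (rule Max_mono) (use assms finite_indep indep_empty in auto)

lemma (in matroid) restr_ground: "restr \<I> E = \<I>"
  using indep_subset_ground by (auto simp: restr_def)

lemma (in matroid) flats_of_rank_top: "flats_of_rank E \<I> (mrank \<I> E) = {E}"
proof -
  have "F = E" if F: "flat E \<I> F" "mrank \<I> F = mrank \<I> E" for F
  proof (rule ccontr)
    assume "F \<noteq> E"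
    then obtain x where x: "x \<in> E - F" using F by (auto simp: flat_def)
    then have "mrank \<I> F < mrank \<I> (insert x F)" using F by (auto simp: flat_def)
    also have "\<dots> \<le> mrank \<I> E" using x F by (intro mrank_mono) (auto simp: flat_def)
    finally show False using F by simp
  qed
  moreover have "flat E \<I> E" by (simp add: flat_def)
  ultimately show ?thesis by (auto simp: flats_of_rank_def)
qed

lemma (in matroid) flat_number_top:
  "flat_number E \<I> (mrank \<I> E) k = card (flats_of_rank E \<I> k)"
  by (simp add: flat_number_def flats_of_rank_top restr_ground)

lemma mrank_image:
  assumes bij: "bij_betw h E E'" and iso: "\<forall>X \<subseteq> E. X \<in> \<I> \<longleftrightarrow> h ` X \<in> \<I>'" and "X \<subseteq> E"
  shows "mrank \<I>' (h ` X) = mrank \<I> X"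
proof -
  have inj: "inj_on h E" using bij by (rule bij_betw_imp_inj_on)
  have "{Y \<in> \<I>'. Y \<subseteq> h ` X} = (`) h ` {Y \<in> \<I>. Y \<subseteq> X}"
  proof (intro equalityI subsetI)
    fix Y assume Y: "Y \<in> {Y \<in> \<I>'. Y \<subseteq> h ` X}"
    then obtain Z where "Z \<subseteq> X" "Y = h ` Z" by (auto simp: subset_image_iff)
    then show "Y \<in> (`) h ` {Y \<in> \<I>. Y \<subseteq> X}" using Y iso \<open>X \<subseteq> E\<close> by auto
  next
    fix Y assume "Y \<in> (`) h ` {Y \<in> \<I>. Y \<subseteq> X}"
    then show "Y \<in> {Y \<in> \<I>'. Y \<subseteq> h ` X}" using iso \<open>X \<subseteq> E\<close> by auto
  qed
  moreover have "card (h ` Y) = card Y" if "Y \<subseteq> X" for Y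
    using that \<open>X \<subseteq> E\<close> inj by (meson card_image inj_on_subset order_trans)
  ultimately have "card ` {Y \<in> \<I>'. Y \<subseteq> h ` X} = card ` {Y \<in> \<I>. Y \<subseteq> X}"
    by (simp add: image_image cong: image_cong_simp)
  then show ?thesis by (simp add: mrank_def)
qed

lemma card_flats_of_rank_iso:
  assumes "matroid_iso E \<I> E' \<I>'"
  shows "card (flats_of_rank E \<I> k) = card (flats_of_rank E' \<I>' k)"
proof -
  from assms obtain h where bij: "bij_betw h E E'"
    and iso: "\<forall>X \<subseteq> E. X \<in> \<I> \<longleftrightarrow> h ` X \<in> \<I>'" by (auto simp: matroid_iso_def)
  have inj: "inj_on h E" and img: "h ` E = E'" using bij by (auto simp: bij_betw_def)
  have rk: "mrank \<I>' (h ` X) = mrank \<I> X" if "X \<subseteq> E" for X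
    using mrank_image[OF bij iso that] .
  have fl: "flat E' \<I>' (h ` F) \<longleftrightarrow> flat E \<I> F" if F: "F \<subseteq> E" for F
  proof -
    have "E' - h ` F = h ` (E - F)" using inj_on_image_set_diff[OF inj, of E F] F img by auto
    moreover have "mrank \<I>' (insert (h x) (h ` F)) = mrank \<I> (insert x F)" if "x \<in> E - F" for x
      using rk[of "insert x F"] that F by auto
    ultimately show ?thesis using rk[OF F] F img by (auto simp: flat_def)
  qed
  have "flats_of_rank E' \<I>' k = (`) h ` flats_of_rank E \<I> k"
  proof (intro equalityI subsetI)
    fix G assume G: "G \<in> flats_of_rank E' \<I>' k"
    then have "G \<subseteq> h ` E" using img by (auto simp: flats_of_rank_def flat_def)
    then obtain F where "F \<subseteq> E" "G = h ` F" by (auto simp: subset_image_iff)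
    then show "G \<in> (`) h ` flats_of_rank E \<I> k" using G fl rk by (auto simp: flats_of_rank_def)
  next
    fix G assume "G \<in> (`) h ` flats_of_rank E \<I> k"
    then obtain F where "G = h ` F" "flat E \<I> F" "mrank \<I> F = k" "F \<subseteq> E"
      by (auto simp: flats_of_rank_def flat_def)
    then show "G \<in> flats_of_rank E' \<I>' k" using fl rk by (auto simp: flats_of_rank_def)
  qed
  moreover have "inj_on ((`) h) (flats_of_rank E \<I> k)"
    by (rule inj_on_subset[OF inj_on_image_Pow[OF inj]]) (auto simp: flats_of_rank_def flat_def)
  ultimately show ?thesis by (simp add: card_image)
qed

lemma (in spmd) flat_number_hyperplane:
  assumes "hyperplane E \<I> H"
  shows "flat_number E \<I> (mrank \<I> E - 1) k = card (flats_of_rank H (restr \<I> H) k)"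
proof -
  let ?m = "mrank \<I> E - 1"
  have H: "H \<in> flats_of_rank E \<I> ?m" and less: "?m < mrank \<I> E"
    using assms by (auto simp: hyperplane_def flats_of_rank_def)
  have "card (flats_of_rank F (restr \<I> F) k) = card (flats_of_rank H (restr \<I> H) k)"
    if "F \<in> flats_of_rank E \<I> ?m" for F
    by (rule card_flats_of_rank_iso[OF flats_iso[OF less that H]])
  with H show ?thesis unfolding flat_number_def by (intro the_equality) metis+
qed

end

theory Submission
  imports Defs
begin

text \<open>Inclusion-exclusion over the subsets \<open>S\<close> of \<open>B\<close> reduces the count to the number of
  hyperplanes containing \<open>S\<close>. Such a hyperplane contains the closure of \<open>S\<close>, a flat whose rank
  \<open>k\<close> is the cardinality of \<open>S\<close>, so \<open>f(r, r - 1, k)\<close> of them exist. Counting the pairs of a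
  rank-\<open>k\<close> flat inside a hyperplane in two ways gives
  \<open>\<langle>r | k\<rangle> f(r, r - 1, k) = \<langle>r | r - 1\<rangle> \<langle>r - 1 | k\<rangle>\<close>. The set \<open>B\<close> itself lies in no hyperplane.\<close>

text \<open>After the two summations are swapped, a set \<open>H\<close> contributes the alternating
  sum over the subsets of \<open>H \<inter> B\<close>, which vanishes unless that intersection is
  empty.\<close>

lemma card_disjoint_inclusion_exclusion:
  assumes "finite B" "finite \<H>"
  shows "(of_nat (card {H \<in> \<H>. H \<inter> B = {}}) :: 'c :: comm_ring_1) =
    (\<Sum>S \<in> Pow B. (-1) ^ card S * of_nat (card {H \<in> \<H>. S \<subseteq> H}))"
proof -
  have alternating: "(\<Sum>S | S \<in> Pow B \<and> S \<subseteq> H. (-1) ^ card S :: 'c) = (if H \<inter> B = {} then 1 else 0)"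
    for H
  proof -
    have "finite (H \<inter> B)" and "{S. S \<in> Pow B \<and> S \<subseteq> H} = Pow (H \<inter> B)" using assms by auto
    \<comment> \<open>Expanding the product of \<open>1 - 1\<close> over \<open>H \<inter> B\<close>
      yields the alternating sum, and \<open>0 ^ n\<close> is 1 only for
      \<open>n = 0\<close>.\<close>
    then show ?thesis
      using prod_diff_conv_sum[of "H \<inter> B" "\<lambda>_. 1 :: 'c" "\<lambda>_. 1"] by (simp add: power_0_left)
  qed
  have "(\<Sum>S \<in> Pow B. (-1) ^ card S * of_nat (card {H \<in> \<H>. S \<subseteq> H}) :: 'c) =
      (\<Sum>S \<in> Pow B. \<Sum>H | H \<in> \<H> \<and> S \<subseteq> H. (-1) ^ card S)"
    by (simp add: mult.commute)
  also have "\<dots> = (\<Sum>H \<in> \<H>. \<Sum>S | S \<in> Pow B \<and> S \<subseteq> H. (-1) ^ card S)"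
    by (rule sum.swap_restrict) (use assms in auto)
  also have "\<dots> = (\<Sum>H \<in> \<H>. if H \<inter> B = {} then 1 else 0)"
    by (simp only: alternating)
  also have "\<dots> = of_nat (card {H \<in> \<H>. H \<inter> B = {}})"
    using assms by (simp flip: sum.inter_filter)
  finally show ?thesis by simp
qed

lemma sum_Pow_card:
  fixes g :: "nat \<Rightarrow> 'c :: comm_semiring_1"
  assumes "finite B"
  shows "(\<Sum>S \<in> Pow B. g (card S)) = (\<Sum>k\<le>card B. of_nat (card B choose k) * g k)"
proof -
  have "(\<Sum>S \<in> Pow B. g (card S)) =
      (\<Sum>k\<le>card B. \<Sum>S | S \<in> Pow B \<and> card S = k. g (card S))"
    by (rule sum.group[symmetric]) (use assms in \<open>auto intro: card_mono\<close>)
  also have "\<dots> = (\<Sum>k\<le>card B. of_nat (card B choose k) * g k)"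
    using assms by (intro sum.cong) (simp_all add: n_subsets)
  finally show ?thesis .
qed

context matroid
begin

lemma finite_if_indep: "X \<in> \<I> \<Longrightarrow> finite X"
  using indep_subset_ground finite_ground finite_subset by blast

lemma card_le_mrank:
  assumes "Y \<in> \<I>" "Y \<subseteq> X"
  shows "card Y \<le> mrank \<I> X"
  unfolding mrank_def by (rule Max_ge) (use assms finite_indep in auto)

lemma indep_attaining_mrank:
  obtains Y where "Y \<in> \<I>" "Y \<subseteq> X" "card Y = mrank \<I> X"
proof -
  have "mrank \<I> X \<in> card ` {Y \<in> \<I>. Y \<subseteq> X}"
    unfolding mrank_def by (rule Max_in) (use finite_indep indep_empty in auto)
  then show ?thesis using that by auto
qed

lemma mrank_indep:
  assumes "S \<in> \<I>"
  shows "mrank \<I> S = card S"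
proof -
  obtain Y where "Y \<in> \<I>" "Y \<subseteq> S" "card Y = mrank \<I> S" by (rule indep_attaining_mrank)
  then have "mrank \<I> S \<le> card S" using assms finite_if_indep card_mono by metis
  with card_le_mrank[OF assms order_refl] show ?thesis by simp
qed

text \<open>Augmenting from a largest independent subset of \<open>X\<close> lowers the deficit
  \<open>mrank \<I> X - card S\<close> by one each time.\<close>

lemma indep_extend_to_mrank:
  assumes "S \<in> \<I>" "S \<subseteq> X"
  obtains J where "J \<in> \<I>" "S \<subseteq> J" "J \<subseteq> X" "card J = mrank \<I> X"
proof -
  have "\<exists>J. J \<in> \<I> \<and> S \<subseteq> J \<and> J \<subseteq> X \<and> card J = mrank \<I> X"
    using assms
  proof (induction "mrank \<I> X - card S" arbitrary: S)
    case 0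
    then have "card S = mrank \<I> X" using card_le_mrank[of S X] by simp
    with 0 show ?case by blast
  next
    case (Suc n)
    obtain Y where Y: "Y \<in> \<I>" "Y \<subseteq> X" "card Y = mrank \<I> X" by (rule indep_attaining_mrank)
    moreover from Y Suc.hyps(2) have "card S < card Y" by linarith
    ultimately obtain y where y: "y \<in> Y - S" "insert y S \<in> \<I>"
      using indep_augment[of S Y] Suc.prems by blast
    then have "n = mrank \<I> X - card (insert y S)"
      using Suc.hyps(2) finite_if_indep[OF Suc.prems(1)] by simp
    then show ?case using Suc.hyps(1)[of "insert y S"] y Y Suc.prems by blast
  qed
  then show ?thesis using that by blast
qed

text \<open>If the union had larger rank, a largest independent subset of \<open>X\<close> could be
  augmented by a single \<open>y\<close> from the union, and then \<open>insert y X\<close> would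
  already have larger rank than \<open>X\<close>.\<close>

lemma mrank_union_eq:
  assumes "\<And>y. y \<in> Y \<Longrightarrow> mrank \<I> (insert y X) = mrank \<I> X"
  shows "mrank \<I> (X \<union> Y) = mrank \<I> X"
proof (rule antisym)
  show "mrank \<I> X \<le> mrank \<I> (X \<union> Y)" by (rule mrank_mono) simp
  show "mrank \<I> (X \<union> Y) \<le> mrank \<I> X"
  proof (rule ccontr)
    assume less: "\<not> mrank \<I> (X \<union> Y) \<le> mrank \<I> X"
    obtain I where I: "I \<in> \<I>" "I \<subseteq> X" "card I = mrank \<I> X" by (rule indep_attaining_mrank)
    obtain J where J: "J \<in> \<I>" "J \<subseteq> X \<union> Y" "card J = mrank \<I> (X \<union> Y)"
      by (rule indep_attaining_mrank)
    obtain y where y: "y \<in> J - I" "insert y I \<in> \<I>"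
      using indep_augment[of I J] I J less by auto
    have "Suc (mrank \<I> X) \<le> mrank \<I> (insert y X)"
      using card_le_mrank[OF y(2), of "insert y X"] I y finite_if_indep by auto
    moreover have "mrank \<I> (insert y X) = mrank \<I> X"
      using assms y J by (cases "y \<in> X") (auto simp: insert_absorb)
    ultimately show False by simp
  qed
qed

text \<open>Diminishing returns, the form of submodularity used below: an element that raises the
  rank of a set raises that of every subset.\<close>

lemma mrank_insert_less_mono:
  assumes "X \<subseteq> Y" "mrank \<I> Y < mrank \<I> (insert x Y)"
  shows "mrank \<I> X < mrank \<I> (insert x X)"
proof -
  obtain I where I: "I \<in> \<I>" "I \<subseteq> X" "card I = mrank \<I> X" by (rule indep_attaining_mrank)
  obtain J where J: "J \<in> \<I>" "I \<subseteq> J" "J \<subseteq> Y" "card J = mrank \<I> Y"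
    using indep_extend_to_mrank[of I Y] I assms(1) by blast
  obtain K where K: "K \<in> \<I>" "K \<subseteq> insert x Y" "card K = mrank \<I> (insert x Y)"
    by (rule indep_attaining_mrank)
  obtain y where y: "y \<in> K - J" "insert y J \<in> \<I>"
    using indep_augment[of J K] J K assms(2) by auto
  \<comment> \<open>\<open>J\<close> already has the largest size possible inside \<open>Y\<close>,
    so the augmenting element can only be \<open>x\<close>; shrinking \<open>J\<close> to
    \<open>I\<close> keeps independence.\<close>
  have "\<not> insert y J \<subseteq> Y"
    using card_le_mrank[OF y(2), of Y] J y finite_if_indep by auto
  then have "y = x" using y J K by auto
  then have "insert x I \<in> \<I>" "x \<notin> I"
    using indep_subset[OF y(2), of "insert x I"] y J by auto
  then show ?thesis
    using card_le_mrank[of "insert x I" "insert x X"] I finite_if_indep[of I] insert_mono[of I X x]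
    by simp
qed

text \<open>The bound \<open>x \<in> E\<close> matters, since elements outside the ground set never
  raise a rank.\<close>

definition closure :: "'a set \<Rightarrow> 'a set" where
  "closure S = {x \<in> E. mrank \<I> (insert x S) = mrank \<I> S}"

lemma subset_closure: "S \<subseteq> E \<Longrightarrow> S \<subseteq> closure S"
  by (auto simp: closure_def insert_absorb)

lemma mrank_closure:
  assumes "S \<subseteq> E"
  shows "mrank \<I> (closure S) = mrank \<I> S"
  using mrank_union_eq[of "closure S" S] subset_closure[OF assms]
  by (simp add: closure_def Un_absorb1)

lemma flat_closure:
  assumes "S \<subseteq> E"
  shows "flat E \<I> (closure S)"
  unfolding flat_def
proof (intro conjI ballI)
  show "closure S \<subseteq> E" by (auto simp: closure_def)
  fix x assume "x \<in> E - closure S"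
  then have "mrank \<I> (insert x S) \<noteq> mrank \<I> S" by (simp add: closure_def)
  moreover have "mrank \<I> S \<le> mrank \<I> (insert x S)" by (rule mrank_mono) auto
  moreover have "mrank \<I> (insert x S) \<le> mrank \<I> (insert x (closure S))"
    by (rule mrank_mono) (use subset_closure[OF assms] in auto)
  ultimately show "mrank \<I> (closure S) < mrank \<I> (insert x (closure S))"
    using mrank_closure[OF assms] by simp
qed

text \<open>An element of the closure outside \<open>G\<close> would raise the rank of
  \<open>G\<close> but not that of \<open>S\<close>, against diminishing returns.\<close>

lemma closure_subset_flat_iff:
  assumes "flat E \<I> G" "S \<subseteq> E"
  shows "closure S \<subseteq> G \<longleftrightarrow> S \<subseteq> G"
proof
  assume "S \<subseteq> G"
  show "closure S \<subseteq> G"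
  proof
    fix x assume "x \<in> closure S"
    then have "x \<in> E" "\<not> mrank \<I> S < mrank \<I> (insert x S)" by (auto simp: closure_def)
    with mrank_insert_less_mono[OF \<open>S \<subseteq> G\<close>] show "x \<in> G" using assms by (auto simp: flat_def)
  qed
qed (use subset_closure[OF assms(2)] in blast)

lemma mrank_restr: "X \<subseteq> F \<Longrightarrow> mrank (restr \<I> F) X = mrank \<I> X"
  unfolding mrank_def restr_def by (rule arg_cong[of _ _ "\<lambda>A. Max (card ` A)"]) auto

text \<open>Elements outside the flat \<open>H\<close> raise its rank, hence also the rank of any
  \<open>F \<subseteq> H\<close>, so flatness of \<open>F\<close> is decided by the elements of
  \<open>H\<close> alone.\<close>

lemma flats_of_rank_restr:
  assumes "flat E \<I> H"
  shows "flats_of_rank H (restr \<I> H) k = {F \<in> flats_of_rank E \<I> k. F \<subseteq> H}"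
proof -
  have "flat H (restr \<I> H) F \<longleftrightarrow> flat E \<I> F" if F: "F \<subseteq> H" for F
  proof -
    have restr: "mrank (restr \<I> H) F = mrank \<I> F"
      "x \<in> H \<Longrightarrow> mrank (restr \<I> H) (insert x F) = mrank \<I> (insert x F)" for x
      using F by (auto intro!: mrank_restr)
    have "mrank \<I> F < mrank \<I> (insert x F)" if "x \<in> E - H" for x
      using mrank_insert_less_mono[OF F] assms that by (auto simp: flat_def)
    then show ?thesis using restr F assms by (fastforce simp: flat_def)
  qed
  moreover have "F \<subseteq> H" if "flat H (restr \<I> H) F" for F using that by (simp add: flat_def)
  ultimately show ?thesis using mrank_restr by (auto simp: flats_of_rank_def)
qed

lemma finite_flats_of_rank: "finite (flats_of_rank E \<I> k)"
  by (rule finite_subset[of _ "Pow E"]) (use finite_ground in \<open>auto simp: flats_of_rank_def flat_def\<close>)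

text \<open>Bases are defined as maximal under inclusion; extension to full rank shows that they
  also have maximal size.\<close>

lemma card_basis:
  assumes "basis \<I> B"
  shows "card B = mrank \<I> E"
proof -
  have "B \<in> \<I>" using assms by (simp add: basis_def)
  then obtain J where "J \<in> \<I>" "B \<subseteq> J" "card J = mrank \<I> E"
    using indep_extend_to_mrank indep_subset_ground by metis
  with assms show ?thesis by (auto simp: basis_def)
qed

end

lemma (in spmd) card_hyperplanes_above_indep:
  assumes "S \<in> \<I>" "card S < mrank \<I> E"
  shows "flat_number E \<I> (mrank \<I> E) (card S) * card {H. hyperplane E \<I> H \<and> S \<subseteq> H} =
    flat_number E \<I> (mrank \<I> E) (mrank \<I> E - 1) * flat_number E \<I> (mrank \<I> E - 1) (card S)"
    (is "?eq")
    and "flat_number E \<I> (mrank \<I> E) (card S) > 0"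
proof -
  let ?r = "mrank \<I> E" and ?k = "card S"
  let ?F = "flats_of_rank E \<I> ?k" and ?H = "flats_of_rank E \<I> (?r - 1)"
  have "S \<subseteq> E" using assms(1) by (rule indep_subset_ground)
  \<comment> \<open>The rank of \<open>E\<close> is positive here, so the subtraction in
    \<open>?r - 1\<close> does not truncate.\<close>
  have hyp: "hyperplane E \<I> H \<longleftrightarrow> H \<in> ?H" for H
    using assms(2) by (auto simp: hyperplane_def flats_of_rank_def)
  have cl: "closure S \<in> ?F"
    using \<open>S \<subseteq> E\<close> assms(1) flat_closure mrank_closure mrank_indep by (simp add: flats_of_rank_def)
  then show "flat_number E \<I> ?r ?k > 0"
    using finite_flats_of_rank by (auto simp: flat_number_top card_gt_0_iff)
  obtain f :: "nat \<Rightarrow> nat \<Rightarrow> nat" where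
    f: "\<And>s u F. F \<in> flats_of_rank E \<I> u \<Longrightarrow> card {G \<in> flats_of_rank E \<I> s. F \<subseteq> G} = f s u"
    using flats_above by blast
  have "{H. hyperplane E \<I> H \<and> S \<subseteq> H} = {H \<in> ?H. closure S \<subseteq> H}"
    using closure_subset_flat_iff \<open>S \<subseteq> E\<close> by (auto simp: hyp flats_of_rank_def)
  then have above: "card {H. hyperplane E \<I> H \<and> S \<subseteq> H} = f (?r - 1) ?k"
    using f[OF cl] by simp
  have "card {F \<in> ?F. F \<subseteq> H} = flat_number E \<I> (?r - 1) ?k" if "H \<in> ?H" for H
    using flat_number_hyperplane[of H] flats_of_rank_restr[of H] that
    by (simp add: hyp) (simp add: flats_of_rank_def)
  \<comment> \<open>Double counting of the pairs \<open>F \<subseteq> H\<close>, here grouped by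
    hyperplane and next by \<open>F\<close>.\<close>
  then have "(\<Sum>F \<in> ?F. card {H \<in> ?H. F \<subseteq> H}) = flat_number E \<I> (?r - 1) ?k * card ?H"
    by (intro sum_multicount finite_flats_of_rank) auto
  moreover have "(\<Sum>F \<in> ?F. card {H \<in> ?H. F \<subseteq> H}) = card ?F * f (?r - 1) ?k"
    by (simp add: f)
  ultimately show ?eq by (simp add: above flat_number_top mult.commute)
qed

theorem theorem1:
  fixes E :: "'a set" and \<I> :: "'a set set" and B :: "'a set" and r :: nat
  assumes "spmd E \<I>"
    and "mrank \<I> E = r"
    and "basis \<I> B"
  shows "real (card {H. hyperplane E \<I> H \<and> H \<inter> B = {}}) =
    (\<Sum>k<r. (-1) ^ k *
       (real (r choose k) * real (flat_number E \<I> r (r - 1)) * real (flat_number E \<I> (r - 1) k)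
         / real (flat_number E \<I> r k)))"
proof -
  interpret spmd E \<I> by (rule assms(1))
  let ?\<H> = "{H. hyperplane E \<I> H}"
  \<comment> \<open>The number of hyperplanes containing a \<open>k\<close>-element subset of
    \<open>B\<close>; the default 0 covers \<open>B\<close> itself.\<close>
  define g where "g k = (if k < r then
    real (flat_number E \<I> r (r - 1)) * real (flat_number E \<I> (r - 1) k) / real (flat_number E \<I> r k)
    else 0)" for k
  have B: "B \<in> \<I>" "card B = r" "finite B"
    using assms card_basis finite_if_indep by (auto simp: basis_def)
  have "finite ?\<H>"
    by (rule finite_subset[of _ "Pow E"]) (use finite_ground in \<open>auto simp: hyperplane_def flat_def\<close>)
  have above: "real (card {H \<in> ?\<H>. S \<subseteq> H}) = g (card S)" if "S \<subseteq> B" for S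
  proof (cases "card S < r")
    case True
    have "S \<in> \<I>" using B(1) that by (rule indep_subset)
    then have "real (flat_number E \<I> r (card S)) * real (card {H \<in> ?\<H>. S \<subseteq> H}) =
        real (flat_number E \<I> r (r - 1)) * real (flat_number E \<I> (r - 1) (card S))"
      and "flat_number E \<I> r (card S) > 0"
      using card_hyperplanes_above_indep[of S] True assms(2) by (simp_all flip: of_nat_mult)
    then show ?thesis using True by (simp add: g_def field_simps)
  next
    case False
    \<comment> \<open>An independent set of at least \<open>r\<close> elements inside
      \<open>H\<close> would push the rank of \<open>H\<close> above \<open>r - 1\<close>.\<close>
    have "\<not> S \<subseteq> H" if "hyperplane E \<I> H" for H
      using card_le_mrank[of S H] indep_subset[OF B(1) \<open>S \<subseteq> B\<close>] that False assms(2)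
      by (auto simp: hyperplane_def)
    then have "{H \<in> ?\<H>. S \<subseteq> H} = {}" by auto
    then show ?thesis using False by (simp only: g_def) simp
  qed
  have "real (card {H. hyperplane E \<I> H \<and> H \<inter> B = {}}) =
      (\<Sum>S \<in> Pow B. (-1) ^ card S * real (card {H \<in> ?\<H>. S \<subseteq> H}))"
    using card_disjoint_inclusion_exclusion[OF B(3) \<open>finite ?\<H>\<close>, where 'c = real] by simp
  also have "\<dots> = (\<Sum>S \<in> Pow B. (-1) ^ card S * g (card S))"
    by (rule sum.cong) (use above in auto)
  also have "\<dots> = (\<Sum>k\<le>r. real (r choose k) * ((-1) ^ k * g k))"
    using sum_Pow_card[OF B(3), of "\<lambda>k. (-1) ^ k * g k"] B(2) by simp
  also have "\<dots> = (\<Sum>k<r. real (r choose k) * ((-1) ^ k * g k))"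
    by (rule sum.mono_neutral_right) (auto simp: g_def)
  also have "\<dots> = (\<Sum>k<r. (-1) ^ k *
       (real (r choose k) * real (flat_number E \<I> r (r - 1)) * real (flat_number E \<I> (r - 1) k)
         / real (flat_number E \<I> r k)))"
    by (rule sum.cong) (simp_all add: g_def)
  finally show ?thesis .
qed

end
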